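(* Let $T,S\in \mathcal{B}_A(\mathcal{H})$. Then $$\omega_{A,\mathrm{e}}(T,S) \leq \left[\omega_A\Big((T^\sharp T)^2 + (S^\sharp S)^2\Big) + 2\,\omega_A^2\big(S^\sharp T\big)\right]^{\frac{1}{4}}.$$
   Context: $\mathcal{H}$ is a complex Hilbert space with inner product $\langle\cdot\mid\cdot\rangle$, $\mathcal{B}(\mathcal{H})$ is the algebra of bounded linear operators on $\mathcal{H}$, and $A\in\mathcal{B}(\mathcal{H})$ is a fixed nonzero positive (semidefinite) operator. Put $\langle x\mid y\rangle_A=\langle Ax\mid y\rangle$ and $\|x\|_A=\langle x\mid x\rangle_A^{1/2}$. $\mathcal{B}_A(\mathcal{H})=\{T\in\mathcal{B}(\mathcal{H}) : \mathcal{R}(T^*A)\subseteq\mathcal{R}(A)\}$, where $\mathcal{R}$ denotes range; for $T\in\mathcal{B}_A(\mathcal{H})$, $T^\sharp$ denotes the unique $X\in\mathcal{B}(\mathcal{H})$ with $AX=T^*A$ and $\mathcal{R}(X)\subseteq\overline{\mathcal{R}(A)}$ (so $\langle Tx\mid y\rangle_A=\langle x\mid T^\sharp y\rangle_A$). For $T,S\in\mathcal{B}_A(\mathcal{H})$: $\omega_A(T)=\sup\{|\langle Tx\mid x\rangle_A| : \|x\|_A=1\}$ and $\omega_{A,\mathrm{e}}(T,S)=\sup\{(|\langle Tx\mid x\rangle_A|^2+|\langle Sx\mid x\rangle_A|^2)^{1/2} : \|x\|_A=1\}$; both are finite. *)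

theory Defs
  imports "HOL-Analysis.Analysis"
begin

text \<open>
  A complex Hilbert space, as a class on top of \<open>banach\<close> (so norm, topology and completeness are the
  library's). The inner product is linear in its first argument. Positive definiteness is contained
  in \<open>cinner_self\<close>, since the norm is nonnegative and vanishes only at 0; the remaining vector space
  laws for \<open>scaleC\<close> follow from \<open>scaleC_of_real\<close>.
\<close>

class complex_hilbert_space = banach +
  fixes scaleC :: "complex \<Rightarrow> 'a \<Rightarrow> 'a"  (infixr \<open>*\<^sub>C\<close> 75)
    and cinner :: "'a \<Rightarrow> 'a \<Rightarrow> complex"
  assumes scaleC_add_right: "a *\<^sub>C (x + y) = a *\<^sub>C x + a *\<^sub>C y"
    and scaleC_add_left: "(a + b) *\<^sub>C x = a *\<^sub>C x + b *\<^sub>C x"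
    and scaleC_scaleC: "a *\<^sub>C (b *\<^sub>C x) = (a * b) *\<^sub>C x"
    and scaleC_of_real: "complex_of_real r *\<^sub>C x = r *\<^sub>R x"
    and cinner_commute: "cinner x y = cnj (cinner y x)"
    and cinner_add_left: "cinner (x + y) z = cinner x z + cinner y z"
    and cinner_scaleC_left: "cinner (a *\<^sub>C x) y = a * cinner x y"
    and cinner_self: "cinner x x = complex_of_real ((norm x)\<^sup>2)"

instantiation complex :: complex_hilbert_space
begin

definition scaleC_complex :: "complex \<Rightarrow> complex \<Rightarrow> complex"
  where "scaleC_complex a x = a * x"

definition cinner_complex :: "complex \<Rightarrow> complex \<Rightarrow> complex"
  where "cinner_complex x y = x * cnj y"

instance
proof
  fix x :: complex
  show "cinner x x = complex_of_real ((norm x)\<^sup>2)"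
    unfolding cinner_complex_def by (rule complex_norm_square [symmetric])
qed (simp_all add: scaleC_complex_def cinner_complex_def ring_distribs mult.assoc
    scaleR_conv_of_real)

end

definition bounded_clinear :: "('a::complex_hilbert_space \<Rightarrow> 'a) \<Rightarrow> bool"
  where "bounded_clinear T \<longleftrightarrow> bounded_linear T \<and> (\<forall>c x. T (c *\<^sub>C x) = c *\<^sub>C T x)"

definition positive_operator :: "('a::complex_hilbert_space \<Rightarrow> 'a) \<Rightarrow> bool"
  where "positive_operator A \<longleftrightarrow>
    bounded_clinear A \<and> (\<forall>x. cinner (A x) x \<in> \<real> \<and> 0 \<le> Re (cinner (A x) x))"

definition cadjoint :: "('a::complex_hilbert_space \<Rightarrow> 'a) \<Rightarrow> 'a \<Rightarrow> 'a"
  where "cadjoint T =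
    (THE S. bounded_clinear S \<and> (\<forall>x y. cinner (T x) y = cinner x (S y)))"

definition inner_A :: "('a::complex_hilbert_space \<Rightarrow> 'a) \<Rightarrow> 'a \<Rightarrow> 'a \<Rightarrow> complex"
  where "inner_A A x y = cinner (A x) y"

definition norm_A :: "('a::complex_hilbert_space \<Rightarrow> 'a) \<Rightarrow> 'a \<Rightarrow> real"
  where "norm_A A x = sqrt (Re (inner_A A x x))"

definition B_A :: "('a::complex_hilbert_space \<Rightarrow> 'a) \<Rightarrow> ('a \<Rightarrow> 'a) set"
  where "B_A A = {T. bounded_clinear T \<and> range (cadjoint T \<circ> A) \<subseteq> range A}"

definition sharp :: "('a::complex_hilbert_space \<Rightarrow> 'a) \<Rightarrow> ('a \<Rightarrow> 'a) \<Rightarrow> 'a \<Rightarrow> 'a"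
  where "sharp A T =
    (THE X. bounded_clinear X \<and> A \<circ> X = cadjoint T \<circ> A \<and> range X \<subseteq> closure (range A))"

definition omega_A :: "('a::complex_hilbert_space \<Rightarrow> 'a) \<Rightarrow> ('a \<Rightarrow> 'a) \<Rightarrow> real"
  where "omega_A A T = (SUP x\<in>{x. norm_A A x = 1}. cmod (inner_A A (T x) x))"

definition omega_Ae ::
    "('a::complex_hilbert_space \<Rightarrow> 'a) \<Rightarrow> ('a \<Rightarrow> 'a) \<Rightarrow> ('a \<Rightarrow> 'a) \<Rightarrow> real"
  where "omega_Ae A T S = (SUP x\<in>{x. norm_A A x = 1}.
    sqrt ((cmod (inner_A A (T x) x))\<^sup>2 + (cmod (inner_A A (S x) x))\<^sup>2))"

end

theory Submission
  imports Defs
begin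

text \<open>
  For a vector \<open>x\<close> of \<open>A\<close>-seminorm 1, the Boas-Bellman inequality applied to \<open>T x\<close> and \<open>S x\<close> bounds
  the square of the sum of the squared moduli of \<open>inner_A A (T x) x\<close> and \<open>inner_A A (S x) x\<close> by the
  squared Frobenius norm of the Gram matrix of \<open>T x\<close> and \<open>S x\<close>. Its off-diagonal entry is
  \<open>inner_A A (sharp A S (T x)) x\<close>. By Cauchy-Schwarz, the squares of its diagonal entries are at
  most the values at \<open>x\<close> of the quadratic forms of \<open>(sharp A T \<circ> T) ^^ 2\<close> and \<open>(sharp A S \<circ> S) ^^ 2\<close>.

  Since \<open>sharp\<close> is a definite description and the suprema are only meaningful for bounded sets, the
  argument also needs that \<open>sharp A T\<close> exists (Douglas) and that the members of \<open>B_A A\<close> are bounded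
  for the \<open>A\<close>-seminorm (Krein's iteration).
\<close>

section \<open>Inner products\<close>

lemma scaleC_minus_one: "(-1) *\<^sub>C x = - (x::'a::complex_hilbert_space)"
  using scaleC_of_real[of "-1" x] by simp

lemma cinner_add_right: "cinner x (y + z) = cinner x y + cinner x z"
  using cinner_add_left[of y z x] by (metis cinner_commute complex_cnj_add)

lemma cinner_scaleC_right: "cinner x (a *\<^sub>C y) = cnj a * cinner x y"
  using cinner_scaleC_left[of a y x] by (metis cinner_commute complex_cnj_mult)

lemma cinner_minus_left: "cinner (- x) y = - cinner x y"
  using cinner_scaleC_left[of "-1" x y] by (simp add: scaleC_minus_one)

lemma cinner_minus_right: "cinner x (- y) = - cinner x y"
  using cinner_scaleC_right[of x "-1" y] by (simp add: scaleC_minus_one)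

lemma cinner_diff_left: "cinner (x - y) z = cinner x z - cinner y z"
  using cinner_add_left[of x "- y" z] by (simp add: cinner_minus_left)

lemma cinner_diff_right: "cinner x (y - z) = cinner x y - cinner x z"
  using cinner_add_right[of x y "- z"] by (simp add: cinner_minus_right)

lemma cinner_zero_left [simp]: "cinner 0 y = 0"
  using cinner_diff_left[of 0 0 y] by simp

lemma cinner_zero_right [simp]: "cinner x 0 = 0"
  using cinner_diff_right[of x 0 0] by simp

lemma cinner_scaleR_left: "cinner (r *\<^sub>R x) y = of_real r * cinner x y"
  by (metis cinner_scaleC_left scaleC_of_real)

lemma cinner_scaleR_right: "cinner x (r *\<^sub>R y) = of_real r * cinner x y"
  by (metis cinner_scaleC_right scaleC_of_real complex_cnj_complex_of_real)

lemma cmod_cinner_commute: "cmod (cinner x y) = cmod (cinner y x)"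
  by (subst cinner_commute) simp

lemma cinner_eq_zero_commute: "cinner x y = 0 \<longleftrightarrow> cinner y x = 0"
  by (metis cmod_cinner_commute norm_eq_zero)

lemma cinner_self_eq_zero: "cinner x x = 0 \<longleftrightarrow> x = 0"
  by (simp add: cinner_self)

lemma cinner_ext:
  assumes "\<And>u. cinner u x = cinner u y"
  shows "x = y"
  using assms[of "x - y"] cinner_self_eq_zero[of "x - y"] by (simp add: cinner_diff_right)

section \<open>Bounded complex-linear maps and positive operators\<close>

lemma bounded_clinearD:
  assumes "bounded_clinear T"
  shows "T (x + y) = T x + T y" "T (c *\<^sub>C x) = c *\<^sub>C T x" "T (x - y) = T x - T y"
    "T 0 = 0" "T (r *\<^sub>R x) = r *\<^sub>R T x"
proof -
  have "bounded_linear T" using assms by (simp add: bounded_clinear_def)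
  then show "T (x + y) = T x + T y" "T (x - y) = T x - T y"
    "T 0 = 0" "T (r *\<^sub>R x) = r *\<^sub>R T x"
    by (simp_all add: linear_simps)
  show "T (c *\<^sub>C x) = c *\<^sub>C T x" using assms by (simp add: bounded_clinear_def)
qed

lemma bounded_clinearI:
  assumes "\<And>x y. T (x + y) = T x + T y" "\<And>c x. T (c *\<^sub>C x) = c *\<^sub>C T x"
    and "\<And>x. norm (T x) \<le> norm x * K"
  shows "bounded_clinear T"
  unfolding bounded_clinear_def
proof
  show "bounded_linear T"
  proof (rule bounded_linear_intro[where K = K])
    fix r x show "T (r *\<^sub>R x) = r *\<^sub>R T x"
      using assms(2)[of "complex_of_real r" x] by (simp only: scaleC_of_real)
  qed (fact assms)+
qed (simp add: assms)

text \<open>Polarization of a real quadratic form: the argument \<open>x + y\<close> makes the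
  imaginary parts of the two mixed terms cancel, and \<open>x + \<i> *\<^sub>C y\<close> makes their
  real parts agree.\<close>

lemma positive_operator_adjoint:
  assumes "positive_operator A"
  shows "cinner (A x) y = cinner x (A y)"
proof -
  have A: "bounded_clinear A" and re: "Im (cinner (A z) z) = 0" for z
    using assms by (auto simp: positive_operator_def complex_is_Real_iff)
  have "Im (cinner (A x) y) + Im (cinner (A y) x) = 0"
    using re[of "x + y"] re[of x] re[of y]
    by (simp add: bounded_clinearD[OF A] cinner_add_left cinner_add_right)
  moreover have "Re (cinner (A x) y) - Re (cinner (A y) x) = 0"
    using re[of "x + \<i> *\<^sub>C y"] re[of x] re[of y]
    by (simp add: bounded_clinearD[OF A] cinner_add_left cinner_add_right
        cinner_scaleC_left cinner_scaleC_right)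
  ultimately have "cinner (A x) y = cnj (cinner (A y) x)"
    by (simp add: complex_eq_iff)
  also have "\<dots> = cinner x (A y)" by (rule cinner_commute[symmetric])
  finally show ?thesis .
qed

section \<open>The semi-inner product and the seminorm induced by \<open>A\<close>\<close>

lemma inner_A_commute:
  assumes "positive_operator A"
  shows "inner_A A x y = cnj (inner_A A y x)"
  unfolding inner_A_def by (metis assms positive_operator_adjoint cinner_commute)

lemma norm_A_square:
  assumes "positive_operator A"
  shows "(norm_A A x)\<^sup>2 = Re (inner_A A x x)"
  using assms by (simp add: norm_A_def positive_operator_def inner_A_def)

lemma inner_A_self:
  assumes "positive_operator A"
  shows "inner_A A x x = of_real ((norm_A A x)\<^sup>2)"
  using assms
  by (simp add: norm_A_square positive_operator_def inner_A_def complex_eq_iff complex_is_Real_iff)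

lemma norm_A_nonneg:
  assumes "positive_operator A"
  shows "0 \<le> norm_A A x"
  using assms by (simp add: norm_A_def positive_operator_def inner_A_def)

text \<open>The squared seminorm of \<open>x\<close> minus any multiple of \<open>y\<close> is
  nonnegative. The form is only semidefinite, so \<open>norm_A A y = 0\<close> is possible with
  \<open>y\<close> nonzero and is treated separately.\<close>

lemma Cauchy_Schwarz_A:
  assumes A: "positive_operator A"
  shows "cmod (inner_A A x y) \<le> norm_A A x * norm_A A y"
proof -
  define b where "b = inner_A A x y"
  define u v where "u = (norm_A A x)\<^sup>2" and "v = (norm_A A y)\<^sup>2"
  have L: "bounded_clinear A" using A by (simp add: positive_operator_def)
  have uv: "0 \<le> u" "0 \<le> v" by (simp_all add: u_def v_def)
  \<comment> \<open>Scaling \<open>y\<close> by \<open>of_real t * b\<close> aligns the phases: the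
    cross terms become real, which leaves a real quadratic in \<open>t\<close>.\<close>
  have key: "0 \<le> u - 2 * t * (cmod b)\<^sup>2 + t\<^sup>2 * (cmod b)\<^sup>2 * v" for t
  proof -
    define c where "c = of_real t * b"
    have "inner_A A (x - c *\<^sub>C y) (x - c *\<^sub>C y)
        = inner_A A x x - cnj c * b - c * inner_A A y x + c * cnj c * inner_A A y y"
      unfolding inner_A_def b_def
      by (simp add: bounded_clinearD[OF L] cinner_diff_left cinner_diff_right
          cinner_scaleC_left cinner_scaleC_right algebra_simps)
    also have "\<dots> = of_real u - 2 * of_real t * (b * cnj b) + (of_real t)\<^sup>2 * (b * cnj b) * of_real v"
      using inner_A_commute[OF A, of y x]
      by (simp add: inner_A_self[OF A] c_def u_def v_def b_def[symmetric] algebra_simps power2_eq_square)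
    also have "b * cnj b = of_real ((cmod b)\<^sup>2)" by (rule complex_norm_square[symmetric])
    finally have "inner_A A (x - c *\<^sub>C y) (x - c *\<^sub>C y)
        = of_real (u - 2 * t * (cmod b)\<^sup>2 + t\<^sup>2 * (cmod b)\<^sup>2 * v)"
      by (simp only: of_real_diff of_real_add of_real_mult of_real_power of_real_numeral)
    then have "(norm_A A (x - c *\<^sub>C y))\<^sup>2 = u - 2 * t * (cmod b)\<^sup>2 + t\<^sup>2 * (cmod b)\<^sup>2 * v"
      unfolding norm_A_square[OF A] by (simp only: Re_complex_of_real)
    then show ?thesis using zero_le_power2 by metis
  qed
  have "(cmod b)\<^sup>2 \<le> u * v"
  proof (cases "v = 0")
    case True
    show ?thesis
    proof (rule ccontr)
      assume "\<not> ?thesis"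
      then have b: "(cmod b)\<^sup>2 > 0" using True by simp
      \<comment> \<open>For \<open>v = 0\<close> the expression is affine in \<open>t\<close>; this
        choice of \<open>t\<close> drives it down to \<open>- u - 2\<close>.\<close>
      then have "2 * ((u + 1) / (cmod b)\<^sup>2) * (cmod b)\<^sup>2 = 2 * (u + 1)" by simp
      moreover have "0 \<le> u - 2 * t * (cmod b)\<^sup>2" for t using key[of t] True by simp
      ultimately have "0 \<le> u - 2 * (u + 1)" by metis
      then show False using uv by simp
    qed
  next
    case False
    \<comment> \<open>The quadratic attains its minimum at \<open>t = 1 / v\<close>.\<close>
    then show ?thesis using key[of "1 / v"] uv by (simp add: field_simps power2_eq_square)
  qed
  then have "(cmod b)\<^sup>2 \<le> (norm_A A x * norm_A A y)\<^sup>2"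
    by (simp add: u_def v_def power_mult_distrib)
  then show ?thesis
    unfolding b_def by (rule power2_le_imp_le) (simp add: norm_A_nonneg[OF A])
qed

text \<open>The seminorm version with the identity as positive operator.\<close>

lemma Cauchy_Schwarz: "cmod (cinner x y) \<le> norm x * norm y"
proof -
  have "positive_operator (\<lambda>x::'a. x)"
    by (auto simp: positive_operator_def bounded_clinear_def cinner_self bounded_linear_ident)
  from Cauchy_Schwarz_A[OF this, of x y] show ?thesis
    by (simp add: inner_A_def norm_A_def cinner_self)
qed

lemma bounded_linear_cinner_left: "bounded_linear (\<lambda>x. cinner x y)"
  by (rule bounded_linear_intro[where K = "norm y"])
    (simp_all add: cinner_add_left cinner_scaleR_left scaleR_conv_of_real Cauchy_Schwarz)

text \<open>The norm is homogeneous for complex scalars because \<open>cinner_self\<close> expresses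
  it through the inner product.\<close>

lemma bounded_linear_scaleC: "bounded_linear (\<lambda>x::'a::complex_hilbert_space. c *\<^sub>C x)"
proof (rule bounded_linear_intro[where K = "cmod c"])
  fix x :: 'a and r
  show "c *\<^sub>C r *\<^sub>R x = r *\<^sub>R c *\<^sub>C x"
    by (simp only: scaleC_of_real[symmetric] scaleC_scaleC mult.commute)
  have "of_real ((norm (c *\<^sub>C x))\<^sup>2) = (c * cnj c) * cinner x x"
    by (simp add: cinner_self[symmetric] cinner_scaleC_left cinner_scaleC_right del: of_real_power)
  also have "\<dots> = of_real ((norm x * cmod c)\<^sup>2)"
    by (simp add: cinner_self complex_norm_square[symmetric] power_mult_distrib)
  finally have "(norm (c *\<^sub>C x))\<^sup>2 = (norm x * cmod c)\<^sup>2" using of_real_eq_iff by blast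
  then show "norm (c *\<^sub>C x) \<le> norm x * cmod c" by (simp add: power2_eq_iff_nonneg)
qed (rule scaleC_add_right)

lemma norm_diff_square: "(norm (x - y))\<^sup>2 = (norm x)\<^sup>2 - 2 * Re (cinner x y) + (norm y)\<^sup>2"
proof -
  have "of_real ((norm (x - y))\<^sup>2) = cinner (x - y) (x - y)" by (rule cinner_self[symmetric])
  also have "\<dots> = cinner x x - cinner x y - cnj (cinner x y) + cinner y y"
    by (simp add: cinner_diff_left cinner_diff_right cinner_commute[of y x])
  finally have "Re (of_real ((norm (x - y))\<^sup>2)) = Re (cinner x x - cinner x y - cnj (cinner x y) + cinner y y)"
    by simp
  then show ?thesis by (simp add: cinner_self)
qed

lemma parallelogram:
  fixes x y :: "'a::complex_hilbert_space"
  shows "(norm (x + y))\<^sup>2 + (norm (x - y))\<^sup>2 = 2 * (norm x)\<^sup>2 + 2 * (norm y)\<^sup>2"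
proof -
  have "(norm (x + y))\<^sup>2 = (norm x)\<^sup>2 + 2 * Re (cinner x y) + (norm y)\<^sup>2"
    using norm_diff_square[of x "- y"]
    by (simp only: diff_minus_eq_add cinner_minus_right uminus_complex.sel norm_minus_cancel)
  with norm_diff_square[of x y] show ?thesis by linarith
qed

section \<open>Orthogonal projections and adjoints\<close>

text \<open>The parallelogram law makes a minimizing sequence for the distance from \<open>x\<close>
  to \<open>M\<close> Cauchy. Its limit is a nearest point, and perturbing a nearest point inside
  \<open>M\<close> forces orthogonality.\<close>

lemma orthogonal_projection:
  fixes x :: "'a::complex_hilbert_space"
  assumes "closed M" and "0 \<in> M"
    and add: "\<And>u v. u \<in> M \<Longrightarrow> v \<in> M \<Longrightarrow> u + v \<in> M"
    and scale: "\<And>c u. u \<in> M \<Longrightarrow> c *\<^sub>C u \<in> M"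
  obtains p where "p \<in> M" and "\<And>m. m \<in> M \<Longrightarrow> cinner (x - p) m = 0"
proof -
  define d where "d = (INF m\<in>M. (norm (x - m))\<^sup>2)"
  have bdd: "bdd_below ((\<lambda>m. (norm (x - m))\<^sup>2) ` M)" by (rule bdd_belowI[of _ 0]) auto
  have d: "d \<le> (norm (x - m))\<^sup>2" if "m \<in> M" for m
    unfolding d_def by (rule cINF_lower[OF bdd that])
  have "\<exists>m\<in>M. (norm (x - m))\<^sup>2 < d + 1 / real (Suc n)" for n
    using cINF_less_iff[OF _ bdd, of "d + 1 / real (Suc n)"] \<open>0 \<in> M\<close> by (auto simp: d_def)
  then obtain m where m: "\<And>n. m n \<in> M" "\<And>n. (norm (x - m n))\<^sup>2 < d + 1 / real (Suc n)"
    by metis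
  have close: "(dist (m i) (m j))\<^sup>2 \<le> 2 / real (Suc i) + 2 / real (Suc j)" for i j
  proof -
    \<comment> \<open>The midpoint stays in \<open>M\<close>, so its squared distance to
      \<open>x\<close> is at least \<open>d\<close>; the parallelogram law then leaves little room
      for \<open>dist (m i) (m j)\<close>.\<close>
    have "(1/2) *\<^sub>R (m i + m j) \<in> M"
      using scale[OF add[OF m(1) m(1)], of "of_real (1/2)" i j] by (simp only: scaleC_of_real)
    then have "d \<le> (norm (x - (1/2) *\<^sub>R (m i + m j)))\<^sup>2" by (rule d)
    also have "x - (1/2) *\<^sub>R (m i + m j) = (1/2) *\<^sub>R ((x - m i) + (x - m j))"
      by (simp add: algebra_simps flip: scaleR_add_left)
    finally have "4 * d \<le> (norm ((x - m i) + (x - m j)))\<^sup>2" by (simp add: power_mult_distrib power_divide)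
    moreover have "norm ((x - m i) - (x - m j)) = dist (m i) (m j)"
      by (simp add: dist_norm norm_minus_commute)
    ultimately show ?thesis
      using parallelogram[of "x - m i" "x - m j"] m(2)[of i] m(2)[of j] by simp
  qed
  have "Cauchy m"
  proof (rule metric_CauchyI)
    fix e :: real assume "e > 0"
    then obtain N where N: "4 / e\<^sup>2 < real N" using reals_Archimedean2 by blast
    have "dist (m i) (m j) < e" if "i \<ge> N" "j \<ge> N" for i j
    proof -
      have "2 / real (Suc k) < e\<^sup>2 / 2" if "k \<ge> N" for k
      proof -
        have "4 / e\<^sup>2 < real (Suc k)" using N that by linarith
        then show ?thesis using \<open>e > 0\<close> by (simp add: field_simps)
      qed
      from this[OF that(1)] this[OF that(2)] have "(dist (m i) (m j))\<^sup>2 < e\<^sup>2"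
        using close[of i j] by linarith
      then show ?thesis using \<open>e > 0\<close> by (simp add: power2_less_imp_less)
    qed
    then show "\<exists>N. \<forall>i\<ge>N. \<forall>j\<ge>N. dist (m i) (m j) < e" by blast
  qed
  then obtain p where p: "m \<longlonglongrightarrow> p" using Cauchy_convergent_iff convergent_def by blast
  have pM: "p \<in> M" using \<open>closed M\<close> m(1) p by (rule closed_sequentially)
  have "(norm (x - p))\<^sup>2 \<le> d"
  proof (rule LIMSEQ_le)
    show "(\<lambda>n. (norm (x - m n))\<^sup>2) \<longlonglongrightarrow> (norm (x - p))\<^sup>2" by (intro tendsto_intros p)
    show "(\<lambda>n. d + 1 / real (Suc n)) \<longlonglongrightarrow> d"
      using tendsto_add[OF tendsto_const LIMSEQ_inverse_real_of_nat, of d] by (simp add: inverse_eq_divide)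
  qed (use m(2) less_imp_le in blast)
  then have min: "(norm (x - p))\<^sup>2 \<le> (norm (x - u))\<^sup>2" if "u \<in> M" for u
    using d[OF that] by (rule order_trans)
  have "cinner (x - p) u = 0" if u: "u \<in> M" for u
  proof -
    define b where "b = cinner (x - p) u"
    \<comment> \<open>A step so short that the quadratic term of the perturbation cannot outweigh
      the linear one; the \<open>+ 1\<close> also covers \<open>u = 0\<close>.\<close>
    define t where "t = 1 / ((norm u)\<^sup>2 + 1)"
    have t: "t > 0" "t * (norm u)\<^sup>2 < 1"
      by (simp_all add: t_def add_pos_nonneg add_nonneg_pos divide_less_eq)
    have "(norm ((x - p) - (of_real t * b) *\<^sub>C u))\<^sup>2
        = (norm (x - p))\<^sup>2 - 2 * t * (cmod b)\<^sup>2 + t * (t * (norm u)\<^sup>2) * (cmod b)\<^sup>2"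
    proof -
      have "of_real ((norm ((of_real t * b) *\<^sub>C u))\<^sup>2) = of_real t * of_real t * (b * cnj b) * cinner u u"
        by (simp add: cinner_self[symmetric] cinner_scaleC_left cinner_scaleC_right algebra_simps
            del: of_real_power)
      also have "\<dots> = of_real (t * (t * (norm u)\<^sup>2) * (cmod b)\<^sup>2)"
        by (simp add: cinner_self complex_norm_square[symmetric])
      finally have 1: "(norm ((of_real t * b) *\<^sub>C u))\<^sup>2 = t * (t * (norm u)\<^sup>2) * (cmod b)\<^sup>2"
        using of_real_eq_iff by blast
      have "cinner (x - p) ((of_real t * b) *\<^sub>C u) = of_real t * (b * cnj b)"
        by (simp add: cinner_scaleC_right b_def)
      also have "\<dots> = of_real (t * (cmod b)\<^sup>2)" by (simp add: complex_norm_square[symmetric])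
      finally show ?thesis using 1 by (simp add: norm_diff_square)
    qed
    moreover have "(norm (x - p))\<^sup>2 \<le> (norm ((x - p) - (of_real t * b) *\<^sub>C u))\<^sup>2"
      using min[OF add[OF pM scale[OF u]], of "of_real t * b"] by (simp add: diff_diff_eq)
    ultimately have "2 * t * (cmod b)\<^sup>2 - t * (t * (norm u)\<^sup>2) * (cmod b)\<^sup>2 \<le> 0" by linarith
    then have "t * ((2 - t * (norm u)\<^sup>2) * (cmod b)\<^sup>2) \<le> 0" by (simp add: algebra_simps)
    then have "(2 - t * (norm u)\<^sup>2) * (cmod b)\<^sup>2 \<le> 0" using t by (simp add: mult_le_0_iff)
    then have "(cmod b)\<^sup>2 \<le> 0" using t(2) by (simp add: mult_le_0_iff)
    then show ?thesis by (simp add: b_def)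
  qed
  with pM show thesis using that by blast
qed

text \<open>A vector \<open>z\<close> orthogonal to the closed kernel of \<open>f\<close> represents
  \<open>f\<close> up to a scalar, since \<open>f z *\<^sub>C u - f u *\<^sub>C z\<close> always
  lies in that kernel.\<close>

lemma Riesz_representation:
  fixes f :: "'a::complex_hilbert_space \<Rightarrow> complex"
  assumes f: "bounded_linear f" and fC: "\<And>c x. f (c *\<^sub>C x) = c * f x"
  obtains v where "\<And>x. f x = cinner x v"
proof (cases "\<forall>x. f x = 0")
  case True
  then show thesis using that[of 0] by simp
next
  case False
  then obtain x where x: "f x \<noteq> 0" by blast
  have "closed {u. f u = 0}"
    by (intro closed_Collect_eq continuous_on_const linear_continuous_on f)
  then obtain p where p: "f p = 0" "\<And>m. f m = 0 \<Longrightarrow> cinner (x - p) m = 0"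
    using orthogonal_projection[of "{u. f u = 0}" x] f
    by (auto simp: linear_simps fC)
  define z where "z = x - p"
  have fz: "f z \<noteq> 0" using x p by (simp add: z_def f linear_simps)
  then have nz: "cinner z z \<noteq> 0" by (auto simp: cinner_self_eq_zero f linear_simps)
  have "f u = cinner u ((cnj (f z) / cinner z z) *\<^sub>C z)" for u
  proof -
    have "f (f z *\<^sub>C u - f u *\<^sub>C z) = 0" by (simp add: f linear_simps fC)
    then have "cinner z (f z *\<^sub>C u - f u *\<^sub>C z) = 0" using p(2) by (simp add: z_def)
    then have "cinner (f z *\<^sub>C u - f u *\<^sub>C z) z = 0" by (simp add: cinner_eq_zero_commute[of _ z])
    then have "f z * cinner u z = f u * cinner z z"
      by (simp add: cinner_diff_left cinner_scaleC_left)
    moreover have "cnj (cinner z z) = cinner z z" by (metis cinner_commute)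
    ultimately show ?thesis using nz by (simp add: cinner_scaleC_right field_simps)
  qed
  then show thesis by (rule that)
qed

text \<open>Riesz representation, applied for each fixed \<open>y\<close>, supplies the value
  \<open>S y\<close>; linearity of \<open>S\<close> follows because the inner product separates
  points.\<close>

lemma cadjoint_exists:
  assumes T: "bounded_clinear T"
  shows "\<exists>S. bounded_clinear S \<and> (\<forall>x y. cinner (T x) y = cinner x (S y))"
proof -
  obtain K where K: "\<And>x. norm (T x) \<le> norm x * K" and "K > 0"
    using T unfolding bounded_clinear_def by (meson bounded_linear.pos_bounded)
  have "\<exists>v. \<forall>x. cinner (T x) y = cinner x v" for y
  proof -
    have "bounded_linear (\<lambda>x. cinner (T x) y)"
    proof (rule bounded_linear_intro[where K = "K * norm y"])
      fix x
      have "cmod (cinner (T x) y) \<le> norm (T x) * norm y" by (rule Cauchy_Schwarz)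
      also have "\<dots> \<le> norm x * K * norm y" using K by (simp add: mult_right_mono)
      finally show "cmod (cinner (T x) y) \<le> norm x * (K * norm y)" by (simp add: mult.assoc)
    qed (simp_all add: bounded_clinearD[OF T] cinner_add_left cinner_scaleR_left scaleR_conv_of_real)
    then show ?thesis
      using Riesz_representation[of "\<lambda>x. cinner (T x) y"]
      by (metis bounded_clinearD(2)[OF T] cinner_scaleC_left)
  qed
  then obtain S where S: "\<And>x y. cinner (T x) y = cinner x (S y)" by metis
  have "bounded_clinear S"
  proof (rule bounded_clinearI[where K = K])
    fix x y c
    show "S (x + y) = S x + S y"
      by (rule cinner_ext) (simp add: S[symmetric] cinner_add_right)
    show "S (c *\<^sub>C x) = c *\<^sub>C S x"
      by (rule cinner_ext) (simp add: S[symmetric] cinner_scaleC_right)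
    \<comment> \<open>Moving one \<open>S\<close> back to \<open>T\<close> shows that
      \<open>S\<close> inherits the bound \<open>K\<close> of \<open>T\<close>.\<close>
    have "(norm (S x))\<^sup>2 = cmod (cinner (S x) (S x))" by (simp add: cinner_self norm_power)
    also have "\<dots> = cmod (cinner (T (S x)) x)" by (simp add: S)
    also have "\<dots> \<le> norm (T (S x)) * norm x" by (rule Cauchy_Schwarz)
    also have "\<dots> \<le> norm (S x) * K * norm x" using K by (simp add: mult_right_mono)
    finally have "norm (S x) * norm (S x) \<le> norm (S x) * (norm x * K)"
      by (simp add: power2_eq_square mult_ac)
    then show "norm (S x) \<le> norm x * K"
      using \<open>K > 0\<close> by (cases "norm (S x) = 0") (auto simp: mult_le_cancel_left)
  qed
  with S show ?thesis by blast
qed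

lemma cadjoint:
  assumes "bounded_clinear T"
  shows "bounded_clinear (cadjoint T)" and "cinner (T x) y = cinner x (cadjoint T y)"
proof -
  have "\<exists>!S. bounded_clinear S \<and> (\<forall>x y. cinner (T x) y = cinner x (S y))"
  proof (rule ex_ex1I[OF cadjoint_exists[OF assms]])
    fix S S' assume "bounded_clinear S \<and> (\<forall>x y. cinner (T x) y = cinner x (S y))"
      and "bounded_clinear S' \<and> (\<forall>x y. cinner (T x) y = cinner x (S' y))"
    then have "cinner u (S x) = cinner u (S' x)" for u x by metis
    then show "S = S'" by (intro ext) (rule cinner_ext)
  qed
  from theI'[OF this, folded cadjoint_def]
  show "bounded_clinear (cadjoint T)" "cinner (T x) y = cinner x (cadjoint T y)" by blast+
qed

section \<open>The sharp operation\<close>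

text \<open>The closed sets \<open>F n\<close> cover the space, so by Baire one of them contains a
  ball. Differences from the centre of the ball turn this into a bound at every point.\<close>

lemma uniform_boundedness:
  fixes f :: "'i \<Rightarrow> 'a::banach \<Rightarrow> 'b::real_normed_vector"
  assumes lin: "\<And>i. i \<in> I \<Longrightarrow> bounded_linear (f i)"
    and bdd: "\<And>x. \<exists>K. \<forall>i\<in>I. norm (f i x) \<le> K"
  obtains K where "\<And>i x. i \<in> I \<Longrightarrow> norm (f i x) \<le> norm x * K"
proof -
  define F where "F n = {x. \<forall>i\<in>I. norm (f i x) \<le> real n}" for n
  have closed: "closed (F n)" for n
  proof -
    have "F n = (\<Inter>i\<in>I. {x. norm (f i x) \<le> real n})" by (auto simp: F_def)
    then show ?thesis
      by (auto intro!: closed_INT closed_Collect_le continuous_on_const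
          continuous_on_norm[OF linear_continuous_on] lin)
  qed
  have "\<exists>n. x \<in> F n" for x
  proof -
    obtain K where "\<forall>i\<in>I. norm (f i x) \<le> K" using bdd by blast
    moreover obtain n where "K \<le> real n" using real_arch_simple by blast
    ultimately have "x \<in> F n" by (auto simp: F_def intro: order_trans)
    then show ?thesis by blast
  qed
  then have union: "\<Union>(range F) = UNIV" by blast
  have "\<exists>n. interior (F n) \<noteq> {}"
  proof (rule ccontr)
    assume "\<nexists>n. interior (F n) \<noteq> {}"
    then have "interior (\<Union>(range F)) = {}"
      using Baire_category_alt[of "euclidean :: 'a topology" "range F"] closed
      by (auto simp: completely_metrizable_space_euclidean)
    then show False by (simp add: union)
  qed
  then obtain n x0 e where e: "e > 0" "ball x0 e \<subseteq> F n"
    by (metis all_not_in_conv mem_interior)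
  have "norm (f i x) \<le> norm x * (4 * real n / e)" if i: "i \<in> I" for i x
  proof (cases "x = 0")
    case True
    then show ?thesis using lin[OF i] by (simp add: linear_simps)
  next
    case False
    \<comment> \<open>\<open>s *\<^sub>R x\<close> has norm \<open>e / 2\<close>, so
      \<open>x0 + s *\<^sub>R x\<close> stays in the ball; dividing \<open>2 * real n\<close> by
      \<open>s\<close> yields the constant \<open>4 * real n / e\<close>.\<close>
    define s where "s = e / (2 * norm x)"
    have s: "s > 0" using e False by (simp add: s_def)
    have "x0 \<in> F n" "x0 + s *\<^sub>R x \<in> F n"
      using e False by (auto simp: s_def dist_norm intro!: subsetD[OF e(2)])
    then have "norm (f i x0) \<le> real n" "norm (f i (x0 + s *\<^sub>R x)) \<le> real n"
      using i by (auto simp: F_def)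
    then have "norm (f i (x0 + s *\<^sub>R x) - f i x0) \<le> 2 * real n"
      using norm_triangle_ineq4[of "f i (x0 + s *\<^sub>R x)" "f i x0"] by linarith
    then have "s * norm (f i x) \<le> 2 * real n"
      using s by (simp add: lin[OF i] linear_simps)
    then show ?thesis using e False by (simp add: s_def field_simps)
  qed
  then show thesis using that by blast
qed

text \<open>The range inclusion makes \<open>A y = cadjoint T (A x)\<close> solvable. Projecting a
  solution to \<open>M\<close>, where \<open>A\<close> is injective, selects a unique one, and
  uniqueness makes the selection linear.\<close>

lemma sharp_exists:
  assumes A: "positive_operator A" and T: "T \<in> B_A A"
  shows "\<exists>!X. bounded_clinear X \<and> A \<circ> X = cadjoint T \<circ> A \<and> range X \<subseteq> closure (range A)"
proof -
  define M where "M = closure (range A)"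
  have L: "bounded_clinear A" using A by (simp add: positive_operator_def)
  have TL: "bounded_clinear T" using T by (simp add: B_A_def)
  note adj = cadjoint[OF TL]
  have M0: "0 \<in> M" unfolding M_def
    using bounded_clinearD(4)[OF L] closure_subset[of "range A"] by (metis range_eqI subsetD)
  have Madd: "u + v \<in> M" if "u \<in> M" "v \<in> M" for u v
  proof -
    obtain f g where f: "\<forall>n. f n \<in> range A" "f \<longlonglongrightarrow> u" and g: "\<forall>n. g n \<in> range A" "g \<longlonglongrightarrow> v"
      using \<open>u \<in> M\<close> \<open>v \<in> M\<close> unfolding M_def closure_sequential by blast
    have mem: "f n + g n \<in> range A" for n
    proof -
      obtain a b where "f n = A a" "g n = A b" using f(1) g(1) by blast
      then have "f n + g n = A (a + b)" by (simp add: bounded_clinearD[OF L])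
      then show ?thesis by blast
    qed
    show ?thesis unfolding M_def closure_sequential
      by (intro exI[of _ "\<lambda>n. f n + g n"] conjI allI mem tendsto_add[OF f(2) g(2)])
  qed
  have Mscale: "c *\<^sub>C u \<in> M" if "u \<in> M" for c u
  proof -
    obtain f where f: "\<forall>n. f n \<in> range A" "f \<longlonglongrightarrow> u"
      using \<open>u \<in> M\<close> unfolding M_def closure_sequential by blast
    have mem: "c *\<^sub>C f n \<in> range A" for n
    proof -
      obtain a where "f n = A a" using f(1) by blast
      then have "c *\<^sub>C f n = A (c *\<^sub>C a)" by (simp add: bounded_clinearD[OF L])
      then show ?thesis by blast
    qed
    show ?thesis unfolding M_def closure_sequential
      by (intro exI[of _ "\<lambda>n. c *\<^sub>C f n"] conjI allI mem bounded_linear.tendsto[OF bounded_linear_scaleC f(2)])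
  qed
  have Mdiff: "u - v \<in> M" if "u \<in> M" "v \<in> M" for u v
    using Madd[OF that(1) Mscale[OF that(2), of "-1"]] by (simp add: scaleC_minus_one)
  have Mclosed: "closed M" by (simp add: M_def)
  have orth: "cinner z w = 0" if "\<And>y. cinner z (A y) = 0" "w \<in> M" for z w
  proof -
    have "closed {u. cinner u z = 0}"
      by (intro closed_Collect_eq continuous_on_const linear_continuous_on bounded_linear_cinner_left)
    moreover have "range A \<subseteq> {u. cinner u z = 0}"
      using that(1) by (auto simp: cinner_eq_zero_commute[of _ z])
    ultimately have "cinner w z = 0" using that(2) closure_minimal unfolding M_def by blast
    then show ?thesis by (simp add: cinner_eq_zero_commute[of z])
  qed
  \<comment> \<open>As \<open>A\<close> is selfadjoint, its kernel is orthogonal to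
    \<open>range A\<close>, hence to \<open>M\<close>, and meets \<open>M\<close> only in 0.\<close>
  have inj: "u = v" if "u \<in> M" "v \<in> M" "A u = A v" for u v
  proof -
    have "A (u - v) = 0" using that(3) by (simp add: bounded_clinearD[OF L])
    then have "cinner (u - v) (A y) = 0" for y
      using positive_operator_adjoint[OF A, of "u - v" y] by simp
    then have "cinner (u - v) (u - v) = 0" using orth Mdiff[OF that(1,2)] by blast
    then show ?thesis by (simp add: cinner_self_eq_zero)
  qed
  have "\<exists>y\<in>M. A y = cadjoint T (A x)" for x
  proof -
    obtain y where y: "A y = cadjoint T (A x)"
      using T unfolding B_A_def by (auto simp: image_subset_iff) (metis rangeE)
    obtain p where p: "p \<in> M" "\<And>m. m \<in> M \<Longrightarrow> cinner (y - p) m = 0"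
      using orthogonal_projection[OF Mclosed M0 Madd Mscale] by blast
    \<comment> \<open>The squared norm of \<open>A (y - p)\<close> is the inner product of
      \<open>y - p\<close> with this element of \<open>M\<close>, so it vanishes and the projection
      \<open>p\<close> still solves the equation.\<close>
    have "A (A (y - p)) \<in> M" by (simp add: M_def closure_subset[THEN subsetD])
    then have "cinner (A (y - p)) (A (y - p)) = 0"
      using p(2) positive_operator_adjoint[OF A, of "y - p" "A (y - p)"] by simp
    then have "A p = A y" by (simp add: cinner_self_eq_zero bounded_clinearD[OF L])
    with p(1) y show ?thesis by auto
  qed
  then obtain X where X: "\<And>x. X x \<in> M" "\<And>x. A (X x) = cadjoint T (A x)" by metis
  have Xadd: "X (x + y) = X x + X y" for x y
    by (rule inj) (simp_all add: X Madd bounded_clinearD[OF L] bounded_clinearD[OF adj(1)])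
  have Xscale: "X (c *\<^sub>C x) = c *\<^sub>C X x" for c x
    by (rule inj) (simp_all add: X Mscale bounded_clinearD[OF L] bounded_clinearD[OF adj(1)])
  have pairing: "cinner (X u) (A v) = cinner u (A (T v))" for u v
    using positive_operator_adjoint[OF A] adj(2) X(2) by (metis cinner_commute)
  \<comment> \<open>By the pairing, \<open>u \<mapsto> cinner (X u) (A v)\<close> is continuous for each \<open>v\<close>, and \<open>range A\<close> is dense in \<open>M\<close>;
    uniform boundedness therefore replaces the closed graph theorem.\<close>
  define I where "I = {v. norm (A v) \<le> 1}"
  obtain K where K: "\<And>v u. v \<in> I \<Longrightarrow> cmod (cinner u (A (T v))) \<le> norm u * K"
  proof (rule uniform_boundedness[of I "\<lambda>v u. cinner u (A (T v))"])
    fix v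
    show "bounded_linear (\<lambda>u. cinner u (A (T v)))"
      by (rule bounded_linear_cinner_left)
  next
    fix u
    have "cmod (cinner u (A (T v))) \<le> norm (X u)" if "v \<in> I" for v
    proof -
      have "cmod (cinner (X u) (A v)) \<le> norm (X u) * norm (A v)" by (rule Cauchy_Schwarz)
      also have "\<dots> \<le> norm (X u)" using that by (simp add: I_def mult_left_le)
      finally show ?thesis by (simp add: pairing)
    qed
    then show "\<exists>K. \<forall>v\<in>I. cmod (cinner u (A (T v))) \<le> K" by blast
  qed (use that in blast)
  \<comment> \<open>Rescaling \<open>v\<close> into \<open>I\<close> gives the estimate on
    \<open>range A\<close>, and continuity in \<open>w\<close> extends it to the closure
    \<open>M\<close>. Taking \<open>w = X u\<close> afterwards bounds \<open>X\<close>
    itself.\<close>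
  have bound: "cmod (cinner (X u) w) \<le> norm u * K * norm w" if "w \<in> M" for u w
  proof -
    have 1: "cmod (cinner (X u) (A v)) \<le> norm u * K * norm (A v)" for v
    proof (cases "A v = 0")
      case False
      define r where "r = 1 / norm (A v)"
      have "r *\<^sub>R v \<in> I" using False by (simp add: I_def bounded_clinearD[OF L] r_def)
      then have "cmod (cinner (X u) (A (r *\<^sub>R v))) \<le> norm u * K" using K by (simp add: pairing)
      then show ?thesis using False
        by (simp add: bounded_clinearD[OF L] cinner_scaleR_right norm_mult norm_divide r_def field_simps)
    qed simp
    have "closed {w. cmod (cinner w (X u)) \<le> norm u * K * norm w}"
      by (intro closed_Collect_le continuous_intros linear_continuous_on bounded_linear_cinner_left)
    moreover have "range A \<subseteq> {w. cmod (cinner w (X u)) \<le> norm u * K * norm w}"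
      using 1 by (auto simp: cmod_cinner_commute[of _ "X u"])
    ultimately have "M \<subseteq> {w. cmod (cinner w (X u)) \<le> norm u * K * norm w}"
      unfolding M_def by (rule closure_minimal[rotated])
    then show ?thesis using that by (auto simp: cmod_cinner_commute[of "X u"])
  qed
  have "bounded_clinear X"
  proof (rule bounded_clinearI[OF Xadd Xscale])
    fix u
    have "norm (X u) * norm (X u) \<le> norm u * K * norm (X u)"
      using bound[OF X(1), of u u] by (simp add: cinner_self power2_eq_square norm_mult)
    then have "norm (X u) \<le> norm u * K \<or> norm (X u) = 0" by (auto simp: mult_le_cancel_right)
    \<comment> \<open>The absolute value covers \<open>X u = 0\<close>, where the sign of
      \<open>K\<close> is not known.\<close>
    then show "norm (X u) \<le> norm u * \<bar>K\<bar>"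
      using mult_left_mono[OF abs_ge_self[of K] norm_ge_zero[of u]] by auto
  qed
  then show ?thesis
  proof (intro ex1I[of _ X] conjI)
    fix Y assume Y: "bounded_clinear Y \<and> A \<circ> Y = cadjoint T \<circ> A \<and> range Y \<subseteq> closure (range A)"
    show "Y = X"
    proof
      fix x
      have "A (Y x) = A (X x)" using Y X(2) by (metis comp_apply)
      moreover have "Y x \<in> M" using Y by (auto simp: M_def)
      ultimately show "Y x = X x" using X(1) inj by blast
    qed
  qed (use X in \<open>auto simp: M_def\<close>)
qed

text \<open>The defining equation of \<open>sharp\<close> read as a pairing. From here on,
  \<open>sharp A T\<close> is handled only through these two properties.\<close>

lemma sharp:
  assumes A: "positive_operator A" and T: "T \<in> B_A A"
  shows "bounded_clinear (sharp A T)"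
    and "inner_A A (sharp A T x) y = inner_A A x (T y)"
proof -
  note sh = theI'[OF sharp_exists[OF assms], folded sharp_def]
  then show "bounded_clinear (sharp A T)" by blast
  have "bounded_clinear T" using T by (simp add: B_A_def)
  moreover have "A (sharp A T x) = cadjoint T (A x)" using sh by (metis comp_apply)
  ultimately show "inner_A A (sharp A T x) y = inner_A A x (T y)"
    unfolding inner_A_def by (metis cadjoint(2) cinner_commute)
qed

section \<open>Boundedness with respect to the seminorm\<close>

text \<open>For an \<open>A\<close>-selfadjoint \<open>P\<close>, repeated squaring gives
  \<open>norm_A (P x) ^ 2 ^ n \<le> norm_A ((P ^^ 2 ^ n) x)\<close>; the right-hand side grows at most like
  \<open>K ^ 2 ^ n\<close> with \<open>K\<close> a bound for the operator norm of \<open>P\<close>.\<close>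

lemma norm_A_selfadjoint_bounded:
  assumes A: "positive_operator A" and P: "bounded_clinear P"
    and sym: "\<And>x y. inner_A A (P x) y = inner_A A x (P y)"
  obtains K where "\<And>x. norm_A A x = 1 \<Longrightarrow> norm_A A (P x) \<le> K"
proof -
  have "bounded_linear P" "bounded_linear A"
    using A P by (simp_all add: positive_operator_def bounded_clinear_def)
  then obtain K C where K: "K > 0" "\<And>x. norm (P x) \<le> norm x * K"
    and C: "C > 0" "\<And>x. norm (A x) \<le> norm x * C"
    by (meson bounded_linear.pos_bounded)
  have powK: "norm ((P ^^ n) x) \<le> norm x * K ^ n" for n x
  proof (induction n)
    case (Suc n)
    have "norm (P ((P ^^ n) x)) \<le> norm ((P ^^ n) x) * K" by (rule K)
    also have "\<dots> \<le> norm x * K ^ n * K" using Suc K(1) by (simp add: mult_right_mono)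
    finally show ?case by (simp add: mult_ac)
  qed simp
  have sym_pow: "inner_A A ((P ^^ n) x) y = inner_A A x ((P ^^ n) y)" for n x y
    by (induction n arbitrary: x) (simp_all add: sym funpow_swap1)
  have norm_A_le: "(norm_A A x)\<^sup>2 \<le> C * (norm x)\<^sup>2" for x
  proof -
    have "(norm_A A x)\<^sup>2 \<le> cmod (cinner (A x) x)"
      unfolding norm_A_square[OF A] inner_A_def by (rule complex_Re_le_cmod)
    also have "\<dots> \<le> norm (A x) * norm x" by (rule Cauchy_Schwarz)
    also have "\<dots> \<le> norm x * C * norm x" using C by (simp add: mult_right_mono)
    finally show ?thesis by (simp add: power2_eq_square mult_ac)
  qed
  have "norm_A A (P x) \<le> K" if x: "norm_A A x = 1" for x
  proof (rule ccontr)
    assume neg: "\<not> norm_A A (P x) \<le> K"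
    define q where "q = norm_A A (P x) / K"
    have q: "q > 1" using neg K(1) by (simp add: q_def)
    \<comment> \<open>Half of the \<open>2 * n\<close> factors move across the form; Cauchy-Schwarz
      against \<open>x\<close>, which has seminorm 1, gives the rest.\<close>
    have square: "(norm_A A ((P ^^ n) x))\<^sup>2 \<le> norm_A A ((P ^^ (2 * n)) x)" for n
    proof -
      have "(norm_A A ((P ^^ n) x))\<^sup>2 = cmod (inner_A A ((P ^^ n) x) ((P ^^ n) x))"
        by (simp add: inner_A_self[OF A] norm_power)
      also have "\<dots> = cmod (inner_A A ((P ^^ (2 * n)) x) x)"
        by (simp add: sym_pow[symmetric] mult_2 funpow_add)
      also have "\<dots> \<le> norm_A A ((P ^^ (2 * n)) x)"
        using Cauchy_Schwarz_A[OF A, of "(P ^^ (2 * n)) x" x] x by simp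
      finally show ?thesis .
    qed
    have iter: "norm_A A (P x) ^ (2 ^ n) \<le> norm_A A ((P ^^ (2 ^ n)) x)" for n
    proof (induction n)
      case (Suc n)
      have "norm_A A (P x) ^ (2 ^ Suc n) = (norm_A A (P x) ^ (2 ^ n))\<^sup>2"
        by (simp add: power_mult[symmetric] mult.commute)
      also have "\<dots> \<le> (norm_A A ((P ^^ (2 ^ n)) x))\<^sup>2"
        using Suc by (simp add: power_mono norm_A_nonneg[OF A])
      also have "\<dots> \<le> norm_A A ((P ^^ (2 * 2 ^ n)) x)" by (rule square)
      finally show ?case by simp
    qed simp
    have "(q ^ (2 ^ n))\<^sup>2 \<le> C * (norm x)\<^sup>2" for n
    proof -
      have "(norm_A A (P x) ^ (2 ^ n))\<^sup>2 \<le> (norm_A A ((P ^^ (2 ^ n)) x))\<^sup>2"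
        by (intro power_mono iter zero_le_power norm_A_nonneg[OF A])
      also have "\<dots> \<le> C * (norm ((P ^^ (2 ^ n)) x))\<^sup>2" by (rule norm_A_le)
      also have "\<dots> \<le> C * (norm x * K ^ (2 ^ n))\<^sup>2"
        using C(1) powK by (intro mult_left_mono power_mono) auto
      finally show ?thesis using K(1)
        by (simp add: q_def power_divide divide_le_eq power_mult_distrib mult_ac)
    qed
    \<comment> \<open>The bound \<open>C * (norm x)\<^sup>2\<close> is the same for all exponents,
      whereas powers of \<open>q > 1\<close> are unbounded.\<close>
    moreover obtain n where n: "C * (norm x)\<^sup>2 < q ^ n" using real_arch_pow[OF q] by blast
    moreover have "n \<le> 2 ^ n * 2" using less_exp[of n] by linarith
    then have "q ^ n \<le> (q ^ (2 ^ n))\<^sup>2"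
      unfolding power_mult[symmetric] using q by (intro power_increasing) auto
    ultimately show False by (meson not_le order_trans)
  qed
  then show thesis by (rule that)
qed

text \<open>Selfadjointness for the semi-inner product: it admits \<open>sharp A T \<circ> T\<close>
  to the iteration above and later turns the form of its square into a squared seminorm.\<close>

lemma norm_A_sharp_comp:
  assumes "positive_operator A" and "T \<in> B_A A"
  shows "inner_A A (sharp A T (T x)) y = inner_A A x (sharp A T (T y))"
  by (metis assms sharp(2) inner_A_commute)

text \<open>The iteration bounds the selfadjoint \<open>sharp A T \<circ> T\<close>; its quadratic
  form at \<open>x\<close> is the squared seminorm of \<open>T x\<close>, so the bound passes to
  \<open>T\<close>.\<close>

lemma B_A_bounded:
  assumes A: "positive_operator A" and T: "T \<in> B_A A"
  shows "\<exists>K. \<forall>x. norm_A A x = 1 \<longrightarrow> norm_A A (T x) \<le> K \<and> norm_A A (sharp A T (T x)) \<le> K"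
proof -
  have "bounded_clinear T" using T by (simp add: B_A_def)
  then have "bounded_clinear (\<lambda>x. sharp A T (T x))"
    using sharp(1)[OF assms] by (auto simp: bounded_clinear_def intro: bounded_linear_compose)
  then obtain K where K: "\<And>x. norm_A A x = 1 \<Longrightarrow> norm_A A (sharp A T (T x)) \<le> K"
    using norm_A_selfadjoint_bounded[OF A, of "\<lambda>x. sharp A T (T x)"] norm_A_sharp_comp[OF assms]
    by blast
  have "norm_A A (T x) \<le> K + 1" if x: "norm_A A x = 1" for x
  proof -
    have "(norm_A A (T x))\<^sup>2 = cmod (inner_A A (sharp A T (T x)) x)"
      by (simp add: sharp(2)[OF assms] inner_A_self[OF A] norm_power)
    also have "\<dots> \<le> norm_A A (sharp A T (T x))" using Cauchy_Schwarz_A[OF A, of _ x] x by force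
    also have "\<dots> \<le> K" by (rule K[OF x])
    finally have "(norm_A A (T x))\<^sup>2 \<le> K" .
    \<comment> \<open>For nonnegative \<open>r\<close> with \<open>r\<^sup>2 \<le> K\<close>,
      expanding \<open>(r - 1)\<^sup>2\<close> gives \<open>r \<le> 2 * r \<le> K + 1\<close>, with
      no square root.\<close>
    moreover have "0 \<le> (norm_A A (T x) - 1)\<^sup>2" by simp
    ultimately show ?thesis using norm_A_nonneg[OF A, of "T x"] by (simp add: power2_diff)
  qed
  with K show ?thesis by (intro exI[of _ "K + 1"]) force
qed

section \<open>The inequality\<close>

text \<open>The combination \<open>w\<close> is chosen so that its pairing with \<open>x\<close> is
  exactly \<open>s\<close>; hence \<open>s\<close> is at most the seminorm of \<open>w\<close>.
  Expanding that seminorm gives a Gram form, compared by Cauchy-Schwarz for the vectors (|a|^2,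
  |b|^2, |ab|, |ab|) and (p, q, h, h), the first of which has Euclidean norm
  \<open>s\<close>.\<close>

lemma Boas_Bellman_A:
  assumes A: "positive_operator A" and x: "norm_A A x = 1"
  shows "((cmod (inner_A A u x))\<^sup>2 + (cmod (inner_A A v x))\<^sup>2)\<^sup>2
    \<le> norm_A A u ^ 4 + norm_A A v ^ 4 + 2 * (cmod (inner_A A u v))\<^sup>2"
proof -
  have L: "bounded_clinear A" using A by (simp add: positive_operator_def)
  define a b g where "a = inner_A A u x" and "b = inner_A A v x" and "g = inner_A A u v"
  define s where "s = (cmod a)\<^sup>2 + (cmod b)\<^sup>2"
  define p q h where "p = (norm_A A u)\<^sup>2" and "q = (norm_A A v)\<^sup>2" and "h = cmod g"
  define w where "w = cnj a *\<^sub>C u + cnj b *\<^sub>C v"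
  have s0: "0 \<le> s" by (simp add: s_def)
  have "inner_A A w x = cnj a * a + cnj b * b"
    by (simp add: w_def inner_A_def a_def b_def bounded_clinearD[OF L] cinner_add_left cinner_scaleC_left)
  also have "\<dots> = of_real s"
    by (simp add: s_def complex_norm_square mult.commute del: of_real_power)
  finally have "s \<le> norm_A A w"
    using Cauchy_Schwarz_A[OF A, of w x] x s0 by simp
  then have 1: "s\<^sup>2 \<le> (norm_A A w)\<^sup>2" using s0 by (rule power_mono)
  have "inner_A A w w = (a * cnj a) * of_real p + (b * cnj b) * of_real q
      + (cnj a * b * g + cnj (cnj a * b * g))"
    using inner_A_commute[OF A, of v u] inner_A_self[OF A, of u] inner_A_self[OF A, of v]
    by (simp add: w_def inner_A_def g_def p_def q_def bounded_clinearD[OF L] cinner_add_left cinner_add_right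
        cinner_scaleC_left cinner_scaleC_right algebra_simps)
  also have "\<dots> = of_real ((cmod a)\<^sup>2 * p + (cmod b)\<^sup>2 * q + 2 * Re (cnj a * b * g))"
    unfolding complex_add_cnj complex_norm_square[symmetric] by simp
  finally have "(norm_A A w)\<^sup>2 = (cmod a)\<^sup>2 * p + (cmod b)\<^sup>2 * q + 2 * Re (cnj a * b * g)"
    by (simp add: norm_A_square[OF A])
  also have "\<dots> \<le> (cmod a)\<^sup>2 * p + (cmod b)\<^sup>2 * q + 2 * (cmod a * cmod b * h)"
    using complex_Re_le_cmod[of "cnj a * b * g"] by (simp add: norm_mult h_def)
  finally have 2: "(norm_A A w)\<^sup>2 \<le> (cmod a)\<^sup>2 * p + (cmod b)\<^sup>2 * q + 2 * (cmod a * cmod b * h)" .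
  \<comment> \<open>Cauchy-Schwarz in dimension four, as a sum of squares\<close>
  have cs: "((cmod a)\<^sup>2 * p + (cmod b)\<^sup>2 * q + 2 * (cmod a * cmod b * h))\<^sup>2
      \<le> s\<^sup>2 * (p\<^sup>2 + q\<^sup>2 + 2 * h\<^sup>2)" (is "?l\<^sup>2 \<le> _")
  proof -
    have "s\<^sup>2 * (p\<^sup>2 + q\<^sup>2 + 2 * h\<^sup>2) - ?l\<^sup>2
      = ((cmod a)\<^sup>2 * q - (cmod b)\<^sup>2 * p)\<^sup>2 + 2 * ((cmod a)\<^sup>2 * h - cmod a * cmod b * p)\<^sup>2
        + 2 * ((cmod b)\<^sup>2 * h - cmod a * cmod b * q)\<^sup>2"
      unfolding s_def by algebra
    then show ?thesis by (smt (verit) zero_le_power2)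
  qed
  have "(s\<^sup>2)\<^sup>2 \<le> s\<^sup>2 * (p\<^sup>2 + q\<^sup>2 + 2 * h\<^sup>2)"
    using power_mono[OF order_trans[OF 1 2], of 2] cs by simp
  then have "s\<^sup>2 \<le> p\<^sup>2 + q\<^sup>2 + 2 * h\<^sup>2"
  proof (cases "s = 0")
    case False
    then have "0 < s\<^sup>2" by simp
    with \<open>(s\<^sup>2)\<^sup>2 \<le> _\<close> show ?thesis
      unfolding power2_eq_square[of "s\<^sup>2"] by (rule mult_left_le_imp_le)
  qed simp
  then show ?thesis by (simp add: s_def a_def b_def p_def q_def h_def g_def flip: power_mult)
qed

theorem theorem2p2:
  fixes A T S :: "'a::complex_hilbert_space \<Rightarrow> 'a"
  assumes "positive_operator A" and "A \<noteq> (\<lambda>x. 0)"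
    and "T \<in> B_A A" and "S \<in> B_A A"
  shows "omega_Ae A T S \<le>
    (omega_A A (\<lambda>x. ((sharp A T \<circ> T) ^^ 2) x + ((sharp A S \<circ> S) ^^ 2) x)
      + 2 * (omega_A A (sharp A S \<circ> T))\<^sup>2) powr (1 / 4)"
proof -
  note A = assms(1) and T = assms(3) and S = assms(4)
  have L: "bounded_clinear A" using A by (simp add: positive_operator_def)
  define B where "B = {x. norm_A A x = 1}"
  define U where "U x = ((sharp A T \<circ> T) ^^ 2) x + ((sharp A S \<circ> S) ^^ 2) x" for x
  \<comment> \<open>A supremum is bounded by a common upper bound only over a nonempty set.
    Cauchy-Schwarz for \<open>z\<close> and \<open>A z\<close> shows that
    \<open>A z \<noteq> 0\<close> forces a nonzero seminorm, so \<open>z\<close> can be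
    normalized.\<close>
  have nonempty: "B \<noteq> {}"
  proof -
    obtain z where "A z \<noteq> 0" using assms(2) by blast
    then have "inner_A A z (A z) \<noteq> 0" by (simp add: inner_A_def cinner_self_eq_zero)
    then have "norm_A A z \<noteq> 0" using Cauchy_Schwarz_A[OF A, of z "A z"] by auto
    moreover have "norm_A A (r *\<^sub>R z) = \<bar>r\<bar> * norm_A A z" for r
      by (simp add: norm_A_def inner_A_def bounded_clinearD[OF L] cinner_scaleR_left
          cinner_scaleR_right real_sqrt_mult flip: mult.assoc)
    ultimately have "norm_A A ((1 / norm_A A z) *\<^sub>R z) = 1"
      using norm_A_nonneg[OF A, of z] by simp
    then show ?thesis by (auto simp: B_def)
  qed
  obtain K where K: "\<And>x. norm_A A x = 1 \<Longrightarrow> norm_A A (T x) \<le> K"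
      "\<And>x. norm_A A x = 1 \<Longrightarrow> norm_A A (sharp A T (T x)) \<le> K"
    using B_A_bounded[OF A T] by blast
  obtain K' where K': "\<And>x. norm_A A x = 1 \<Longrightarrow> norm_A A (S x) \<le> K'"
      "\<And>x. norm_A A x = 1 \<Longrightarrow> norm_A A (sharp A S (S x)) \<le> K'"
    using B_A_bounded[OF A S] by blast
  \<comment> \<open>One selfadjoint factor of each square moves to the right. The value is real and
    nonnegative, so taking \<open>cmod\<close> loses nothing.\<close>
  have U: "inner_A A (U x) x = of_real ((norm_A A (sharp A T (T x)))\<^sup>2 + (norm_A A (sharp A S (S x)))\<^sup>2)" for x
  proof -
    have "inner_A A (U x) x = inner_A A (sharp A T (T (sharp A T (T x)))) x
        + inner_A A (sharp A S (S (sharp A S (S x)))) x"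
      by (simp add: U_def inner_A_def numeral_2_eq_2 bounded_clinearD[OF L] cinner_add_left)
    then show ?thesis
      by (simp add: norm_A_sharp_comp[OF A T, of _ x] norm_A_sharp_comp[OF A S, of _ x] inner_A_self[OF A])
  qed
  have bddU: "bdd_above ((\<lambda>x. cmod (inner_A A (U x) x)) ` B)"
  proof (rule bdd_aboveI2)
    fix x assume "x \<in> B"
    then have "norm_A A x = 1" by (simp add: B_def)
    then show "cmod (inner_A A (U x) x) \<le> K\<^sup>2 + K'\<^sup>2"
      unfolding U norm_of_real
      using K(2) K'(2) by (auto intro!: add_mono power_mono norm_A_nonneg[OF A])
  qed
  \<comment> \<open>This form at \<open>x\<close> pairs \<open>T x\<close> with \<open>S x\<close>,
    so the seminorm bounds of \<open>T\<close> and \<open>S\<close> suffice.\<close>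
  have bddST: "bdd_above ((\<lambda>x. cmod (inner_A A ((sharp A S \<circ> T) x) x)) ` B)"
  proof (rule bdd_aboveI2)
    fix x assume "x \<in> B"
    then have x: "norm_A A x = 1" by (simp add: B_def)
    have "cmod (inner_A A (T x) (S x)) \<le> norm_A A (T x) * norm_A A (S x)"
      by (rule Cauchy_Schwarz_A[OF A])
    also have "\<dots> \<le> K * K'"
      using K(1)[OF x] K'(1)[OF x] norm_A_nonneg[OF A] by (meson mult_mono order_trans)
    finally show "cmod (inner_A A ((sharp A S \<circ> T) x) x) \<le> K * K'" by (simp add: sharp(2)[OF A S])
  qed
  define R where "R = omega_A A U + 2 * (omega_A A (sharp A S \<circ> T))\<^sup>2"
  have "sqrt ((cmod (inner_A A (T x) x))\<^sup>2 + (cmod (inner_A A (S x) x))\<^sup>2) \<le> R powr (1 / 4)"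
    if x: "x \<in> B" for x
  proof -
    define s where "s = (cmod (inner_A A (T x) x))\<^sup>2 + (cmod (inner_A A (S x) x))\<^sup>2"
    have x1: "norm_A A x = 1" using x by (simp add: B_def)
    have fourth: "norm_A A (V x) ^ 4 \<le> (norm_A A (sharp A V (V x)))\<^sup>2" if V: "V \<in> B_A A" for V
    proof -
      have "(norm_A A (V x))\<^sup>2 = cmod (inner_A A (sharp A V (V x)) x)"
        by (simp add: sharp(2)[OF A V] inner_A_self[OF A] norm_power)
      also have "\<dots> \<le> norm_A A (sharp A V (V x))"
        using Cauchy_Schwarz_A[OF A, of "sharp A V (V x)" x] x1 by simp
      finally show ?thesis using power_mono[of "(norm_A A (V x))\<^sup>2" _ 2]
        unfolding power_mult[symmetric] by simp
    qed
    have "s\<^sup>2 \<le> norm_A A (T x) ^ 4 + norm_A A (S x) ^ 4 + 2 * (cmod (inner_A A (T x) (S x)))\<^sup>2"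
      unfolding s_def by (rule Boas_Bellman_A[OF A x1])
    also have "\<dots> \<le> cmod (inner_A A (U x) x) + 2 * (cmod (inner_A A ((sharp A S \<circ> T) x) x))\<^sup>2"
      using fourth[OF T] fourth[OF S] by (simp add: U sharp(2)[OF A S] del: of_real_add of_real_power)
    also have "\<dots> \<le> R"
      unfolding R_def omega_A_def B_def[symmetric]
      by (intro add_mono mult_left_mono power_mono cSUP_upper[OF x] bddU bddST) simp_all
    finally have "s\<^sup>2 \<le> R" .
    then have "(s\<^sup>2) powr (1 / 4) \<le> R powr (1 / 4)" by (intro powr_mono2) auto
    moreover have "0 \<le> s" by (simp add: s_def)
    \<comment> \<open>\<open>s\<close> is the square of the quantity to be bounded, so the fourth
      root of \<open>s\<^sup>2\<close> is that quantity.\<close>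
    then have "(s\<^sup>2) powr (1 / 4) = sqrt s"
      by (cases "s = 0") (simp_all add: powr_half_sqrt[symmetric] powr_powr flip: powr_numeral)
    ultimately show ?thesis by (simp add: s_def)
  qed
  then have "omega_Ae A T S \<le> R powr (1 / 4)"
    unfolding omega_Ae_def B_def[symmetric] using nonempty by (intro cSUP_least) auto
  then show ?thesis unfolding R_def U_def[abs_def] .
qed

end
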